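(* Let $q\ge 2$ and $s\ge q$ be integers. Let $U$ be the unicyclic graph consisting of a cycle of length $2q$ together with, for each vertex of the cycle, exactly $s$ pendant vertices (vertices of degree $1$) adjacent to that cycle vertex, and no other vertices. Let $\ell=2qs$ be the total number of pendant vertices and let $\Delta$ be the distance squared matrix of $U$. Then $i_-(\Delta)=\ell$.
   Context: For a connected graph $G$ with vertices $1,\dots,n$, the distance squared matrix $\Delta$ is the $n\times n$ matrix with $(i,j)$ entry $d_{ij}^2$, where $d_{ij}$ is the graph distance between $i$ and $j$. For a real symmetric matrix $M$, $i_-(M)$ denotes the number of negative eigenvalues of $M$ counted with multiplicity. *)

theory Defs
  imports "Jordan_Normal_Form.Char_Poly" "HOL-Computational_Algebra.Polynomial"
begin

definition graph_dist :: "(nat \<Rightarrow> nat \<Rightarrow> bool) \<Rightarrow> nat \<Rightarrow> nat \<Rightarrow> nat" where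
  "graph_dist adj u v =
     (LEAST k. \<exists>xs. length xs = Suc k \<and> hd xs = u \<and> last xs = v \<and> successively adj xs)"

text \<open>The unicyclic graph U(q,s): cycle vertices 0..<2q (vertex i adjacent to (i+1) mod 2q);
  pendant vertex number j (j < s) attached to cycle vertex i is 2q + i*s + j.\<close>
definition U_adj0 :: "nat \<Rightarrow> nat \<Rightarrow> nat \<Rightarrow> nat \<Rightarrow> bool" where
  "U_adj0 q s u v =
     ((u < 2*q \<and> v < 2*q \<and> v = (u + 1) mod (2*q)) \<or>
      (u < 2*q \<and> (\<exists>j<s. v = 2*q + u*s + j)))"

definition U_adj :: "nat \<Rightarrow> nat \<Rightarrow> nat \<Rightarrow> nat \<Rightarrow> bool" where
  "U_adj q s u v = (U_adj0 q s u v \<or> U_adj0 q s v u)"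

definition U_nverts :: "nat \<Rightarrow> nat \<Rightarrow> nat" where
  "U_nverts q s = 2*q + 2*q*s"

definition dist_sq_matrix :: "nat \<Rightarrow> (nat \<Rightarrow> nat \<Rightarrow> bool) \<Rightarrow> real mat" where
  "dist_sq_matrix n adj = mat n n (\<lambda>(i,j). (real (graph_dist adj i j))^2)"

definition neg_inertia :: "real mat \<Rightarrow> nat" where
  "neg_inertia M = (\<Sum>x\<in>{x. x < 0 \<and> poly (char_poly M) x = 0}. order x (char_poly M))"

end

theory Submission
  imports Defs
begin

text \<open>
  The matrix commutes with the rotation of the cycle and with the permutations of the pendant
  vertices at each cycle vertex, so it has an explicit orthogonal eigenbasis over the complex
  numbers. The vectors supported on the pendant vertices of one cycle vertex with coordinate sum
  $0$ are eigenvectors for $-4$. On the remaining space, the $k$-th Fourier mode with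
  $z = e^{\<pi> i k/q}$ gives a two-dimensional block whose entries are combinations of the Fourier
  coefficients $a$, $b$, $j$ of the squared cycle distance, the cycle distance and the constant $1$.
  For $k \<noteq> 0$ one has $a = 4\<epsilon>q/T$, $b = -2(1-\<epsilon>)/T$, $j = 0$ with
  $\<epsilon> = z^q$ and $T = |1 - z|^2 \<le> 4$. The condition $s \<ge> q$ makes the determinant of every
  block nonpositive, and each block has exactly one negative eigenvalue. In total there are
  $2q(s-1) + 2q = 2qs$ negative eigenvalues.
\<close>

subsection \<open>Distances in the graph\<close>

text \<open>The descent condition builds a walk from \<open>u\<close> to \<open>v\<close> with
  \<open>f v\<close> edges, and the bound along edges shows that no walk from \<open>u\<close> to
  \<open>v\<close> is shorter.\<close>

lemma graph_dist_eqI: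
  fixes f :: "nat \<Rightarrow> nat"
  assumes start: "f u = 0"
    and lip: "\<And>x y. adj x y \<Longrightarrow> f y \<le> f x + 1"
    and desc: "\<And>x k. x \<in> V \<Longrightarrow> f x = Suc k \<Longrightarrow> \<exists>y\<in>V. adj y x \<and> f y = k"
    and zero: "\<And>x. x \<in> V \<Longrightarrow> f x = 0 \<Longrightarrow> x = u"
    and v: "v \<in> V"
  shows "graph_dist adj u v = f v"
  unfolding graph_dist_def
proof (rule Least_equality)
  have "\<exists>xs. length xs = Suc k \<and> hd xs = u \<and> last xs = x \<and> successively adj xs"
    if "x \<in> V" "f x = k" for k x
    using that
  proof (induction k arbitrary: x)
    case 0
    then show ?case using zero by (intro exI[of _ "[u]"]) auto
  next
    case (Suc k)
    then obtain y where y: "y \<in> V" "adj y x" "f y = k" using desc by blast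
    then obtain xs where xs: "length xs = Suc k" "hd xs = u" "last xs = y" "successively adj xs"
      using Suc.IH by blast
    then show ?case using y
      by (intro exI[of _ "xs @ [x]"]) (auto simp: successively_append_iff hd_append)
  qed
  then show "\<exists>xs. length xs = Suc (f v) \<and> hd xs = u \<and> last xs = v \<and> successively adj xs"
    using v by blast
next
  fix k
  have len: "xs \<noteq> [] \<Longrightarrow> successively adj xs \<Longrightarrow> f (last xs) + 1 \<le> f (hd xs) + length xs" for xs
  proof (induction xs rule: induct_list012)
    case (3 x y zs)
    then show ?case using lip[of x y] by fastforce
  qed auto
  assume "\<exists>xs. length xs = Suc k \<and> hd xs = u \<and> last xs = v \<and> successively adj xs"
  then obtain xs where xs: "length xs = Suc k" "hd xs = u" "last xs = v" "successively adj xs"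
    by blast
  moreover from xs(1) have "xs \<noteq> []" by auto
  ultimately show "f v \<le> k" using start len[of xs] by simp
qed

section \<open>Distance on a cycle\<close>

definition cycle_dist :: "nat \<Rightarrow> nat \<Rightarrow> nat \<Rightarrow> nat" where
  "cycle_dist N i j = (if i \<le> j then min (j - i) (N - (j - i)) else min (i - j) (N - (i - j)))"

lemma cycle_dist_self [simp]: "cycle_dist N i i = 0"
  by (simp add: cycle_dist_def)

lemma cycle_dist_eq_0_iff: "i < N \<Longrightarrow> j < N \<Longrightarrow> cycle_dist N i j = 0 \<longleftrightarrow> i = j"
  by (auto simp: cycle_dist_def)

lemma cycle_dist_succ:
  assumes "i < N" "j < N"
  shows "cycle_dist N i ((j + 1) mod N) \<le> cycle_dist N i j + 1"
    "cycle_dist N i j \<le> cycle_dist N i ((j + 1) mod N) + 1"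
proof -
  have "cycle_dist N i (if j + 1 = N then 0 else j + 1) \<le> cycle_dist N i j + 1 \<and>
    cycle_dist N i j \<le> cycle_dist N i (if j + 1 = N then 0 else j + 1) + 1"
    using assms unfolding cycle_dist_def min_def
    by (cases "i \<le> j"; cases "j + 1 = N"; simp; linarith?)
  moreover have "(j + 1) mod N = (if j + 1 = N then 0 else j + 1)" using assms by auto
  ultimately show "cycle_dist N i ((j + 1) mod N) \<le> cycle_dist N i j + 1"
    "cycle_dist N i j \<le> cycle_dist N i ((j + 1) mod N) + 1" by (simp_all only:)
qed

text \<open>The neighbour of \<open>j\<close> along a shorter arc towards \<open>i\<close> is one
  unit closer. Which neighbour this is depends on the order of \<open>i\<close> and \<open>j\<close>
  and on which arc is shorter.\<close>

lemma cycle_dist_descent: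
  assumes "i < N" "j < N" "cycle_dist N i j = Suc k"
  obtains x where "x < N" "x = (j + 1) mod N \<or> j = (x + 1) mod N" "cycle_dist N i x = k"
proof -
  define x where "x = (if j = 0 then N - 1 else j - 1)"
  have s: "(j + 1) mod N = (if j + 1 = N then 0 else j + 1)" using assms by auto
  have x: "x < N" "j = (x + 1) mod N" using assms by (auto simp: x_def)
  have "cycle_dist N i x = k \<or> cycle_dist N i (if j + 1 = N then 0 else j + 1) = k"
  proof (cases "i \<le> j")
    case le: True
    show ?thesis
    proof (cases "j - i \<le> N - (j - i)")
      case True
      then have "k + 1 = j - i" using assms le by (simp add: cycle_dist_def)
      then have "j > 0" "i \<le> j - 1" "j - 1 - i = k" by linarith+
      moreover have "j - 1 - i \<le> N - (j - 1 - i)" using True by linarith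
      ultimately have "cycle_dist N i x = k" by (simp add: x_def cycle_dist_def)
      then show ?thesis ..
    next
      case False
      then have k: "k + 1 = N - (j - i)" using assms le by (simp add: cycle_dist_def)
      then have "cycle_dist N i (if j + 1 = N then 0 else j + 1) = k"
        using False assms le by (cases "j + 1 = N"; simp add: cycle_dist_def; linarith)
      then show ?thesis ..
    qed
  next
    case gt: False
    show ?thesis
    proof (cases "i - j \<le> N - (i - j)")
      case True
      then have k: "k + 1 = i - j" using assms gt by (simp add: cycle_dist_def)
      then have "cycle_dist N i (j + 1) = k" using True assms gt
        by (cases "i = j + 1"; simp add: cycle_dist_def)
      then show ?thesis using gt assms by simp
    next
      case False
      then have k: "k + 1 = N - (i - j)" using assms gt by (simp add: cycle_dist_def)
      then have "cycle_dist N i x = k"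
        using False assms gt by (cases "j = 0"; simp add: x_def cycle_dist_def; linarith)
      then show ?thesis ..
    qed
  qed
  then show thesis
  proof
    assume "cycle_dist N i x = k"
    then show thesis using that x by blast
  next
    assume "cycle_dist N i (if j + 1 = N then 0 else j + 1) = k"
    moreover have "(j + 1) mod N < N" using assms(1) by simp
    ultimately show thesis using that[of "(j + 1) mod N"] s by (simp only: simp_thms)
  qed
qed

text \<open>Rotation invariance: it lets one Fourier coefficient serve all rows of a matrix built
  from the cycle distance.\<close>

lemma cycle_dist_shift:
  assumes "i < N" "d < N"
  shows "cycle_dist N i ((i + d) mod N) = min d (N - d)"
proof (cases "i + d < N")
  case True
  then show ?thesis by (simp add: cycle_dist_def)
next
  case False
  then have "(i + d) mod N = i + d - N" using assms by (simp add: mod_if)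
  moreover have "i - (i + d - N) = N - d" using False assms by linarith
  ultimately show ?thesis using assms False by (simp add: cycle_dist_def min.commute)
qed

section \<open>The distance formula for the unicyclic graph\<close>

definition U_base :: "nat \<Rightarrow> nat \<Rightarrow> nat \<Rightarrow> nat" where
  "U_base q s v = (if v < 2*q then v else (v - 2*q) div s)"

definition U_height :: "nat \<Rightarrow> nat \<Rightarrow> nat" where
  "U_height q v = (if v < 2*q then 0 else 1)"

text \<open>A shortest path runs between the base vertices and has one extra edge for each pendant
  end. Equal vertices are set apart because the sum would give 2 for a pendant vertex and
  itself.\<close>

definition U_dist :: "nat \<Rightarrow> nat \<Rightarrow> nat \<Rightarrow> nat \<Rightarrow> nat" where
  "U_dist q s u v = (if u = v then 0 else
     cycle_dist (2*q) (U_base q s u) (U_base q s v) + U_height q u + U_height q v)"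

lemma U_base_less:
  assumes "v < U_nverts q s"
  shows "U_base q s v < 2*q"
proof (cases "v < 2*q")
  case False
  then have "v - 2*q < 2*q*s" using assms by (auto simp: U_nverts_def)
  then show ?thesis using False by (auto simp: U_base_def less_mult_imp_div_less)
qed (auto simp: U_base_def)

lemma U_base_pendant: "j < s \<Longrightarrow> U_base q s (2*q + i*s + j) = i"
  by (auto simp: U_base_def)

lemma U_adj_cases:
  assumes "U_adj q s x y"
  obtains "x < 2*q" "y = (x + 1) mod (2*q)" | "y < 2*q" "x = (y + 1) mod (2*q)"
  | j where "x < 2*q" "j < s" "y = 2*q + x*s + j" | j where "y < 2*q" "j < s" "x = 2*q + y*s + j"
  using assms unfolding U_adj_def U_adj0_def by blast

lemma U_graph_dist:
  assumes u: "u < U_nverts q s" and v: "v < U_nverts q s"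
  shows "graph_dist (U_adj q s) u v = U_dist q s u v"
proof (rule graph_dist_eqI[where V = "{..<U_nverts q s}"])
  note bu = U_base_less[OF u]
  have cyc: "U_dist q s u y = cycle_dist (2*q) (U_base q s u) y + U_height q u" if "y < 2*q" for y
    using that by (auto simp: U_dist_def U_base_def U_height_def)
  show "U_dist q s u u = 0" by (simp add: U_dist_def)
  show "U_dist q s u y \<le> U_dist q s u x + 1" if "U_adj q s x y" for x y
    using that
  proof (cases rule: U_adj_cases)
    case 1
    then have "y < 2*q" by simp
    moreover have "cycle_dist (2*q) (U_base q s u) y \<le> cycle_dist (2*q) (U_base q s u) x + 1"
      using cycle_dist_succ(1)[OF bu 1(1)] 1(2) by (simp only:)
    ultimately show ?thesis using cyc[of x] cyc[of y] 1(1) by linarith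
  next
    case 2
    then have "x < 2*q" by simp
    moreover have "cycle_dist (2*q) (U_base q s u) y \<le> cycle_dist (2*q) (U_base q s u) x + 1"
      using cycle_dist_succ(2)[OF bu 2(1)] 2(2) by (simp only:)
    ultimately show ?thesis using cyc[of x] cyc[of y] 2(1) by linarith
  next
    case (3 j)
    then show ?thesis using cyc[of x] by (auto simp: U_dist_def U_base_pendant U_height_def)
  next
    case (4 j)
    then show ?thesis using cyc[of y]
      by (auto simp: U_dist_def U_base_pendant U_height_def)
  qed
  show "\<exists>y\<in>{..<U_nverts q s}. U_adj q s y x \<and> U_dist q s u y = k"
    if x: "x \<in> {..<U_nverts q s}" and k: "U_dist q s u x = Suc k" for x k
  proof (cases "x < 2*q")
    case True
    show ?thesis
    \<comment> \<open>If \<open>x\<close> is the base of \<open>u\<close>, then \<open>u\<close> is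
      pendant and is itself the predecessor. Otherwise the predecessor is a neighbour on the
      cycle.\<close>
    proof (cases "cycle_dist (2*q) (U_base q s u) x")
      case 0
      then have "U_base q s u = x" using cycle_dist_eq_0_iff[OF bu True] by simp
      moreover have "u \<noteq> x" using k by (auto simp: U_dist_def)
      ultimately have g: "\<not> u < 2*q" "x = (u - 2*q) div s" by (auto simp: U_base_def)
      have "s > 0" using u g by (cases s) (auto simp: U_nverts_def)
      then have "u = 2*q + x*s + (u - 2*q) mod s" "(u - 2*q) mod s < s" using g by simp_all
      then have "U_adj q s u x" using True unfolding U_adj_def U_adj0_def by blast
      moreover have "k = 0" using k cyc[OF True] 0 g by (auto simp: U_height_def)
      ultimately show ?thesis using u by (auto simp: U_dist_def)
    next
      case (Suc l)
      obtain y where y: "y < 2*q" "y = (x + 1) mod (2*q) \<or> x = (y + 1) mod (2*q)"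
        "cycle_dist (2*q) (U_base q s u) y = l"
        using cycle_dist_descent[OF bu True Suc] .
      then have "U_adj q s y x" using True unfolding U_adj_def U_adj0_def by blast
      moreover have "U_dist q s u y = k" using k cyc[OF True] cyc[OF y(1)] y Suc by simp
      ultimately show ?thesis using y by (auto simp: U_nverts_def)
    qed
  next
    case False
    \<comment> \<open>A pendant vertex can be reached only through its base.\<close>
    define y where "y = U_base q s x"
    have y: "y < 2*q" using U_base_less x by (auto simp: y_def)
    have "s > 0" using x False by (cases s) (auto simp: U_nverts_def)
    then have "x = 2*q + y*s + (x - 2*q) mod s" "(x - 2*q) mod s < s"
      using False by (simp_all add: y_def U_base_def)
    then have "U_adj q s y x" using y unfolding U_adj_def U_adj0_def by blast
    moreover have "U_dist q s u y = k" using k cyc[OF y] False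
      by (auto simp: U_dist_def y_def U_height_def split: if_splits)
    ultimately show ?thesis using y by (auto simp: U_nverts_def)
  qed
  show "x = u" if "x \<in> {..<U_nverts q s}" "U_dist q s u x = 0" for x
    using that cycle_dist_eq_0_iff[OF bu, of x]
    by (auto simp: U_dist_def U_height_def U_base_def split: if_splits)
qed (use v in auto)

subsection \<open>Characteristic polynomials and orthogonal eigenbases\<close>

text \<open>Orthogonality makes the inverse of the eigenvector matrix explicit: it is the conjugate
  transpose with each row divided by a squared norm. Hence \<open>A\<close> is similar to a diagonal
  matrix.\<close>

lemma char_poly_orthogonal_eigenbasis:
  fixes A :: "complex mat" and v :: "nat \<Rightarrow> nat \<Rightarrow> complex"
  assumes A: "A \<in> carrier_mat n n"
    and eig: "\<And>m i. m < n \<Longrightarrow> i < n \<Longrightarrow> (\<Sum>j<n. A $$ (i, j) * v m j) = d m * v m i"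
    and orth: "\<And>m m'. m < n \<Longrightarrow> m' < n \<Longrightarrow> m \<noteq> m' \<Longrightarrow> (\<Sum>i<n. cnj (v m i) * v m' i) = 0"
    and norm: "\<And>m. m < n \<Longrightarrow> (\<Sum>i<n. cnj (v m i) * v m i) \<noteq> 0"
  shows "char_poly A = (\<Prod>m<n. [:- d m, 1:])"
proof -
  define P where "P = mat n n (\<lambda>(i, m). v m i)"
  define Q where "Q = mat n n (\<lambda>(m, i). cnj (v m i) / (\<Sum>i<n. cnj (v m i) * v m i))"
  define D where "D = mat n n (\<lambda>(i, m). if i = m then d m else 0)"
  have carr: "P \<in> carrier_mat n n" "Q \<in> carrier_mat n n" "D \<in> carrier_mat n n"
    by (auto simp: P_def Q_def D_def)
  have QP: "Q * P = 1\<^sub>m n"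
  proof (rule eq_matI)
    fix i j assume "i < dim_row (1\<^sub>m n :: complex mat)" "j < dim_col (1\<^sub>m n :: complex mat)"
    then show "(Q * P) $$ (i, j) = 1\<^sub>m n $$ (i, j)"
      using orth[of i j] norm[of i]
      by (auto simp: P_def Q_def scalar_prod_def atLeast0LessThan simp flip: sum_divide_distrib)
  qed (auto simp: P_def Q_def)
  then have PQ: "P * Q = 1\<^sub>m n" using mat_mult_left_right_inverse carr by blast
  have "A * P = P * D"
  proof (rule eq_matI)
    fix i m assume "i < dim_row (P * D)" "m < dim_col (P * D)"
    then show "(A * P) $$ (i, m) = (P * D) $$ (i, m)"
      using A eig[of m i]
      by (auto simp: P_def D_def scalar_prod_def atLeast0LessThan if_distrib cong: if_cong)
  qed (use A in \<open>auto simp: P_def D_def\<close>)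
  then have "A * (P * Q) = P * D * Q" using A carr by (metis assoc_mult_mat)
  then have "A = P * D * Q" using A PQ by simp
  then have "similar_mat A D"
    unfolding similar_mat_def similar_mat_wit_def Let_def using A carr PQ QP
    by (intro exI[of _ P] exI[of _ Q]) auto
  then have "char_poly A = char_poly D" by (rule char_poly_similar)
  also have "\<dots> = (\<Prod>a\<leftarrow>diag_mat D. [:- a, 1:])"
    by (rule char_poly_upper_triangular[OF carr(3)]) (auto simp: D_def)
  also have "diag_mat D = map d [0..<n]" by (auto simp: diag_mat_def D_def)
  also have "(\<Prod>a\<leftarrow>map d [0..<n]. [:- a, 1:]) = (\<Prod>m<n. [:- d m, 1:])"
    by (simp add: prod.list_conv_set_nth atLeast0LessThan)
  finally show ?thesis .
qed

text \<open>The order of a root \<open>x\<close> counts the indices \<open>m\<close> with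
  \<open>d m = x\<close>, and these index sets are disjoint for different roots.\<close>

lemma neg_inertia_linear_factors:
  fixes n :: nat
  assumes "char_poly M = (\<Prod>m<n. [:- d m, 1:])"
  shows "neg_inertia M = card {m. m < n \<and> d m < 0}"
proof -
  let ?p = "\<Prod>m<n. [:- d m, 1:]"
  have "order x ?p = card {m. m < n \<and> d m = x}" for x
  proof -
    have "order x ?p = (\<Sum>m<n. if d m = x then 1 else 0)"
    proof (induction n)
      case (Suc n)
      have nz: "(\<Prod>m<n. [:- d m, 1:]) * [:- d n, 1:] \<noteq> 0"
        by (intro no_zero_divisors) simp_all
      have "order x [:- d n, 1:] = (if d n = x then 1 else 0)"
        using order_power_n_n[of x 1] by (auto intro!: order_0I)
      then show ?case using order_mult[OF nz, of x] Suc by simp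
    qed (simp add: order_1)
    also have "\<dots> = card {m. m < n \<and> d m = x}"
      by (subst sum.inter_filter[symmetric]) (auto intro!: arg_cong[where f = card])
    finally show ?thesis .
  qed
  moreover have roots: "{x. x < 0 \<and> poly ?p x = 0} = d ` {m. m < n \<and> d m < 0}"
    by (auto simp: poly_prod)
  ultimately have "neg_inertia M = (\<Sum>x\<in>d ` {m. m < n \<and> d m < 0}. card {m. m < n \<and> d m = x})"
    by (simp add: neg_inertia_def assms)
  also have "\<dots> = card (\<Union>x\<in>d ` {m. m < n \<and> d m < 0}. {m. m < n \<and> d m = x})"
    by (rule card_UN_disjoint[symmetric]) auto
  also have "(\<Union>x\<in>d ` {m. m < n \<and> d m < 0}. {m. m < n \<and> d m = x}) = {m. m < n \<and> d m < 0}"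
    by auto
  finally show ?thesis .
qed

subsection \<open>Fourier coefficients of the cycle distance\<close>

lemma sum_lessThan_add:
  fixes f :: "nat \<Rightarrow> 'a::comm_monoid_add"
  shows "(\<Sum>i<m + n. f i) = (\<Sum>i<m. f i) + (\<Sum>i<n. f (m + i))"
  by (induction n) (simp_all add: add.assoc)

text \<open>Substitute \<open>j = (i + d) mod N\<close>; since \<open>z ^ N = 1\<close>, the
  reduction modulo \<open>N\<close> does not affect powers of \<open>z\<close>. Thus powers of
  \<open>z\<close> form an eigenvector of every circulant matrix given by a function of the cycle
  distance.\<close>

lemma cycle_sum_shift:
  fixes z :: complex
  assumes "i < N" and z: "z ^ N = 1"
  shows "(\<Sum>j<N. g (cycle_dist N i j) * z ^ j) = z ^ i * (\<Sum>d<N. g (min d (N - d)) * z ^ d)"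
proof -
  have "inj_on (\<lambda>d. (i + d) mod N) {..<N}"
    using assms(1) by (auto simp: inj_on_def mod_if split: if_splits)
  moreover have "(\<lambda>d. (i + d) mod N) ` {..<N} \<subseteq> {..<N}" using assms(1) by auto
  ultimately have bij: "bij_betw (\<lambda>d. (i + d) mod N) {..<N} {..<N}"
    by (simp add: bij_betw_def endo_inj_surj)
  have pow: "z ^ (m mod N) = z ^ m" for m
  proof -
    have "z ^ m = z ^ (N * (m div N) + m mod N)" by simp
    also have "\<dots> = z ^ (m mod N)" unfolding power_add power_mult z by simp
    finally show ?thesis ..
  qed
  have "(\<Sum>j<N. g (cycle_dist N i j) * z ^ j)
      = (\<Sum>d<N. g (cycle_dist N i ((i + d) mod N)) * z ^ ((i + d) mod N))"
    by (rule sum.reindex_bij_betw[OF bij, symmetric])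
  also have "\<dots> = (\<Sum>d<N. z ^ i * (g (min d (N - d)) * z ^ d))"
    by (intro sum.cong refl) (simp add: cycle_dist_shift assms(1) pow power_add)
  finally show ?thesis by (simp add: sum_distrib_left)
qed

section \<open>Closed forms for the Fourier coefficients\<close>

lemma power_sum_0: "(1 - z) * (\<Sum>d<n. z ^ d) = 1 - (z::complex) ^ n"
proof (induction n)
  case (Suc n)
  show ?case unfolding sum.lessThan_Suc distrib_left Suc.IH by (simp add: algebra_simps)
qed simp

text \<open>Keeping the powers of \<open>1 - z\<close> on the left avoids division, so the induction
  is pure algebra. The same holds for the quadratic sum below.\<close>

lemma power_sum_1:
  "(1 - z)^2 * (\<Sum>d<n. of_nat d * z ^ d) = z - of_nat n * z ^ n + (of_nat n - 1) * z * (z::complex) ^ n"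
proof (induction n)
  case (Suc n)
  show ?case unfolding sum.lessThan_Suc distrib_left Suc.IH
    by (simp add: algebra_simps power2_eq_square)
qed simp

lemma power_sum_2:
  "(1 - z)^3 * (\<Sum>d<n. (of_nat d)^2 * z ^ d) = z + z^2 - (of_nat n)^2 * z ^ n
    + (2 * (of_nat n)^2 - 2 * of_nat n - 1) * z * z ^ n - (of_nat n - 1)^2 * z^2 * (z::complex) ^ n"
proof (induction n)
  case (Suc n)
  show ?case unfolding sum.lessThan_Suc distrib_left Suc.IH
    by (simp add: algebra_simps power2_eq_square power3_eq_cube)
qed (simp add: power2_eq_square)

text \<open>In the second half of the cycle, at \<open>q + d\<close>, the distance back to the start
  is \<open>q - d\<close>, and a factor \<open>z ^ q\<close> comes out.\<close>

lemma cycle_sum_halves: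
  fixes z :: complex
  shows "(\<Sum>d<2*q. g (min d (2*q - d)) * z ^ d)
    = (\<Sum>d<q. g d * z ^ d) + z ^ q * (\<Sum>d<q. g (q - d) * z ^ d)"
proof -
  have "(\<Sum>d<q + q. g (min d (2*q - d)) * z ^ d)
      = (\<Sum>d<q. g (min d (2*q - d)) * z ^ d) + (\<Sum>d<q. g (min (q + d) (2*q - (q + d))) * z ^ (q + d))"
    by (rule sum_lessThan_add)
  also have "(\<Sum>d<q. g (min d (2*q - d)) * z ^ d) = (\<Sum>d<q. g d * z ^ d)"
    by (intro sum.cong refl) (auto simp: min_def)
  also have "(\<Sum>d<q. g (min (q + d) (2*q - (q + d))) * z ^ (q + d)) = (\<Sum>d<q. z ^ q * (g (q - d) * z ^ d))"
  proof (intro sum.cong refl)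
    fix d
    have "min (q + d) (2*q - (q + d)) = q - d" by (auto simp: min_def)
    then show "g (min (q + d) (2*q - (q + d))) * z ^ (q + d) = z ^ q * (g (q - d) * z ^ d)"
      by (simp add: power_add)
  qed
  finally show ?thesis by (simp add: sum_distrib_left mult_2)
qed

lemma cycle_sum_decomp:
  fixes z :: complex and q :: nat
  defines "S0 \<equiv> \<Sum>d<q. z ^ d" and "S1 \<equiv> \<Sum>d<q. of_nat d * z ^ d"
    and "S2 \<equiv> \<Sum>d<q. (of_nat d)^2 * z ^ d"
  shows "(\<Sum>d<2*q. z ^ d) = S0 + z ^ q * S0"
    "(\<Sum>d<2*q. of_nat (min d (2*q - d)) * z ^ d) = S1 + z ^ q * (of_nat q * S0 - S1)"
    "(\<Sum>d<2*q. (of_nat (min d (2*q - d)))^2 * z ^ d)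
      = S2 + z ^ q * ((of_nat q)^2 * S0 - 2 * of_nat q * S1 + S2)"
proof -
  show "(\<Sum>d<2*q. z ^ d) = S0 + z ^ q * S0"
    using cycle_sum_halves[of "\<lambda>_. 1" q z] by (simp add: S0_def)
  have "(\<Sum>d<q. of_nat (q - d) * z ^ d) = (\<Sum>d<q. of_nat q * z ^ d - of_nat d * z ^ d)"
    by (intro sum.cong refl) (simp add: of_nat_diff algebra_simps)
  then have "(\<Sum>d<q. of_nat (q - d) * z ^ d) = of_nat q * S0 - S1"
    by (simp add: S0_def S1_def sum_subtractf sum_distrib_left)
  then show "(\<Sum>d<2*q. of_nat (min d (2*q - d)) * z ^ d) = S1 + z ^ q * (of_nat q * S0 - S1)"
    using cycle_sum_halves[of of_nat q z] by (simp add: S1_def)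
  have "(\<Sum>d<q. (of_nat (q - d))^2 * z ^ d) =
      (\<Sum>d<q. (of_nat q)^2 * z ^ d - 2 * of_nat q * (of_nat d * z ^ d) + (of_nat d)^2 * z ^ d)"
    by (intro sum.cong refl) (simp add: of_nat_diff algebra_simps power2_eq_square)
  then have "(\<Sum>d<q. (of_nat (q - d))^2 * z ^ d) = (of_nat q)^2 * S0 - 2 * of_nat q * S1 + S2"
    by (simp add: S0_def S1_def S2_def sum_subtractf sum.distrib sum_distrib_left)
  then show "(\<Sum>d<2*q. (of_nat (min d (2*q - d)))^2 * z ^ d)
      = S2 + z ^ q * ((of_nat q)^2 * S0 - 2 * of_nat q * S1 + S2)"
    using cycle_sum_halves[of "\<lambda>d. (of_nat d)^2" q z] by (simp add: S2_def)
qed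

text \<open>Here \<open>e\<close> is \<open>z ^ q\<close>, a square root of 1, and \<open>T\<close>
  is the squared modulus of \<open>1 - z\<close>. The sums are found by multiplying with powers of
  \<open>1 - z\<close>.\<close>

lemma cycle_sums_nontrivial:
  fixes z :: complex
  assumes norm: "norm z = 1" and z: "z \<noteq> 1" and zq: "z ^ (2*q) = 1"
  obtains e T :: real where "e = 1 \<or> e = -1" "0 < T" "T \<le> 4"
    "(\<Sum>d<2*q. z ^ d) = 0"
    "(\<Sum>d<2*q. of_nat (min d (2*q - d)) * z ^ d) = of_real (- 2 * (1 - e) / T)"
    "(\<Sum>d<2*q. (of_nat (min d (2*q - d)))^2 * z ^ d) = of_real (4 * e * real q / T)"
proof -
  define T where "T = 2 - 2 * Re z"
  define S0 where "S0 = (\<Sum>d<q. z ^ d)"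
  define S1 where "S1 = (\<Sum>d<q. of_nat d * z ^ d)"
  define S2 where "S2 = (\<Sum>d<q. (of_nat d)^2 * z ^ d)"
  note dec = cycle_sum_decomp[where z = z and q = q, folded S0_def S1_def S2_def]
  note p0 = power_sum_0[of z q, folded S0_def] and p1 = power_sum_1[of z q, folded S1_def]
    and p2 = power_sum_2[of z q, folded S2_def]
  have zcnj: "z * cnj z = 1" using norm by (simp add: complex_norm_square[symmetric])
  have "z + cnj z = of_real (2 * Re z)" by (rule complex_add_cnj)
  then have T_cnj: "of_real T = 2 - z - cnj z" by (simp add: T_def algebra_simps)
  have "z * of_real T = 2 * z - z * z - z * cnj z" unfolding T_cnj by (simp add: algebra_simps)
  \<comment> \<open>On the unit circle the square of \<open>1 - z\<close> is a real multiple of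
    \<open>z\<close>. This is why the coefficients come out real.\<close>
  then have sq: "(1 - z)^2 = - (z * of_real T)" using zcnj by (simp add: power2_eq_square algebra_simps)
  have z0: "z \<noteq> 0" using norm by auto
  have nz: "1 - z \<noteq> 0" using z by simp
  have T0: "T \<noteq> 0"
  proof
    assume "T = 0"
    then have "(1 - z)^2 = 0" using sq by simp
    then show False using nz by simp
  qed
  have "\<bar>Re z\<bar> \<le> 1" using abs_Re_le_cmod[of z] norm by simp
  then have T: "0 < T" "T \<le> 4" using T0 by (auto simp: T_def)
  have quot: "x = of_real (r / T)" if "(1 - z)^2 * x = - (of_real r * z)" for x r
  proof -
    have "z * (of_real T * x) = z * of_real r" using that unfolding sq by (simp add: algebra_simps)
    then have "of_real T * x = of_real r" using z0 by simp
    then show ?thesis using T0 by (simp add: field_simps)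
  qed
  have "(z ^ q)^2 = 1" using zq by (simp add: power_mult[symmetric] mult.commute)
  then consider "z ^ q = 1" | "z ^ q = -1" by (auto simp: power2_eq_1_iff)
  then show thesis
  proof cases
    case 1
    then have S0: "S0 = 0" using p0 nz by simp
    have S1: "(1 - z) * S1 = - of_nat q"
    proof -
      have "(1 - z) * ((1 - z) * S1) = (1 - z) * (- of_nat q)"
        using p1 1 by (simp add: algebra_simps power2_eq_square)
      then show ?thesis by (rule mult_left_cancel[OF nz, THEN iffD1])
    qed
    \<comment> \<open>The closed form of \<open>S2\<close> needs a third power of
      \<open>1 - z\<close>; one factor cancels afterwards.\<close>
    have "(1 - z) * ((1 - z)^2 * (S2 + (S2 - 2 * of_nat q * S1)))
        = 2 * ((1 - z)^3 * S2) - 2 * of_nat q * (1 - z)^2 * ((1 - z) * S1)"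
      by (simp add: algebra_simps power2_eq_square power3_eq_cube)
    also have "\<dots> = (1 - z) * (- (4 * of_nat q * z))"
      unfolding p2 S1 1 by (simp add: algebra_simps power2_eq_square)
    finally have "(1 - z)^2 * (S2 + (S2 - 2 * of_nat q * S1)) = - (4 * of_nat q * z)"
      by (rule mult_left_cancel[OF nz, THEN iffD1])
    then have "(1 - z)^2 * (S2 + (S2 - 2 * of_nat q * S1)) = - (of_real (4 * real q) * z)"
      by simp
    from quot[OF this] show ?thesis
      by (intro that[of 1 T]) (use T dec S0 1 in simp_all)
  next
    case 2
    have S1: "(1 - z)^2 * S1 = z + of_nat q - (of_nat q - 1) * z"
      using p1 2 by simp
    have S0: "(1 - z) * S0 = 2" using p0 2 by simp
    have "(1 - z)^2 * (S1 - (of_nat q * S0 - S1))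
        = 2 * ((1 - z)^2 * S1) - of_nat q * (1 - z) * ((1 - z) * S0)"
      by (simp add: algebra_simps power2_eq_square)
    also have "\<dots> = - (of_real (- 4) * z)" unfolding S1 S0 by (simp add: algebra_simps)
    finally have b: "S1 - (of_nat q * S0 - S1) = of_real (- 4 / T)" by (rule quot)
    \<comment> \<open>For \<open>z ^ q = -1\<close> the two copies of \<open>S2\<close> in the
      decomposition cancel, and only \<open>S0\<close> and \<open>S1\<close> remain.\<close>
    have "(1 - z)^2 * (2 * of_nat q * S1 - (of_nat q)^2 * S0)
        = 2 * of_nat q * ((1 - z)^2 * S1) - (of_nat q)^2 * (1 - z) * ((1 - z) * S0)"
      by (simp add: algebra_simps power2_eq_square)
    also have "\<dots> = - (of_real (- 4 * real q) * z)"
      unfolding S1 S0 by (simp add: algebra_simps power2_eq_square)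
    finally have a: "2 * of_nat q * S1 - (of_nat q)^2 * S0 = of_real (- 4 * real q / T)" by (rule quot)
    have "(\<Sum>d<2*q. z ^ d) = 0" using dec(1) 2 by simp
    moreover have "(\<Sum>d<2*q. of_nat (min d (2*q - d)) * z ^ d) = of_real (- 4 / T)"
      unfolding dec(2) 2 b[symmetric] by simp
    moreover have "(\<Sum>d<2*q. (of_nat (min d (2*q - d)))^2 * z ^ d) = of_real (- 4 * real q / T)"
      unfolding dec(3) 2 a[symmetric] by simp
    ultimately show ?thesis
      by (intro that[of "-1" T]) (use T in simp_all)
  qed
qed

text \<open>At \<open>z = 1\<close> the closed forms above carry no information, so the sums of
  integers and of squares are used instead.\<close>

lemma cycle_sums_trivial:
  "(\<Sum>d<2*q. (1::complex) ^ d) = of_real (2 * real q)"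
  "(\<Sum>d<2*q. of_nat (min d (2*q - d)) * (1::complex) ^ d) = of_real ((real q)^2)"
  "(\<Sum>d<2*q. (of_nat (min d (2*q - d)))^2 * (1::complex) ^ d)
     = of_real (real q * (2 * (real q)^2 + 1) / 3)"
proof -
  define S1 where "S1 = (\<Sum>d<q. of_nat d * (1::complex) ^ d)"
  define S2 where "S2 = (\<Sum>d<q. (of_nat d)^2 * (1::complex) ^ d)"
  note dec = cycle_sum_decomp[where z = 1 and q = q, folded S1_def S2_def]
  have S1: "2 * S1 = of_nat q * (of_nat q - 1)" unfolding S1_def
    by (induction q) (simp_all add: algebra_simps)
  have S2: "6 * S2 = (of_nat q - 1) * of_nat q * (2 * of_nat q - 1)" unfolding S2_def
    by (induction q) (simp_all add: algebra_simps power2_eq_square)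
  show "(\<Sum>d<2*q. (1::complex) ^ d) = of_real (2 * real q)" by simp
  show "(\<Sum>d<2*q. of_nat (min d (2*q - d)) * (1::complex) ^ d) = of_real ((real q)^2)"
    unfolding dec(2) by (simp add: power2_eq_square)
  have third: "x = y / 3" if "6 * x = 2 * y" for x y :: complex
  proof -
    have "x = (6 * x) / 6" by simp
    then show ?thesis unfolding that by simp
  qed
  have "6 * (S2 + ((of_nat q)^2 * of_nat q - 2 * of_nat q * S1 + S2))
      = 2 * (6 * S2) + 6 * (of_nat q)^2 * of_nat q - 6 * of_nat q * (2 * S1)"
    by (simp add: algebra_simps)
  also have "\<dots> = 2 * (of_nat q * (2 * (of_nat q)^2 + 1))"
    unfolding S1 S2 by (simp add: algebra_simps power2_eq_square)
  finally have *: "S2 + ((of_nat q)^2 * of_nat q - 2 * of_nat q * S1 + S2)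
    = of_nat q * (2 * (of_nat q)^2 + 1) / 3" by (rule third)
  show "(\<Sum>d<2*q. (of_nat (min d (2*q - d)))^2 * (1::complex) ^ d)
     = of_real (real q * (2 * (real q)^2 + 1) / 3)"
    unfolding dec(3) using * by simp
qed

text \<open>The last two conditions say that the block with rows $(a, sg)$ and $(g, e)$, where
  $g = a + 2b + j$ and $e = s(a + 4b + 4j) - 4$, has determinant at most $0$, and $a < 0$ if it
  is $0$. The determinant vanishes only for $s = q = k$ odd; this is where $s \<ge> q$ is needed.\<close>

lemma cycle_mode:
  fixes q s k :: nat
  assumes q: "q \<ge> 1" and s: "s \<ge> q" and k: "k < 2*q"
  defines "z \<equiv> cis (2 * pi * real k / real (2*q))"
  obtains j b a :: real where
    "(\<Sum>d<2*q. z ^ d) = of_real j"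
    "(\<Sum>d<2*q. of_nat (min d (2*q - d)) * z ^ d) = of_real b"
    "(\<Sum>d<2*q. (of_nat (min d (2*q - d)))^2 * z ^ d) = of_real a"
    "a + 2*b + j \<noteq> 0"
    "a * (real s * (a + 4*b + 4*j) - 4) \<le> real s * (a + 2*b + j)^2"
    "a * (real s * (a + 4*b + 4*j) - 4) = real s * (a + 2*b + j)^2 \<longrightarrow> a < 0"
proof -
  have Q: "real q \<ge> 1" "real s \<ge> real q" using q s by auto
  note bij = bij_betw_roots_unity[of "2*q"]
  show thesis
  proof (cases "k = 0")
    case True
    then have z1: "z = 1" by (simp add: z_def)
    define x where "x = real q"
    define y where "y = real s"
    define a where "a = x * (2 * x^2 + 1) / 3"
    have x: "x \<ge> 1" and y: "y \<ge> 1" using Q by (auto simp: x_def y_def)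
    have a: "a > 0" using x by (simp add: a_def add_pos_pos)
    \<comment> \<open>This is the determinant of the block for the constant mode, written as a sum
      of terms whose signs are visible.\<close>
    have "a * (y * (a + 4 * x^2 + 4 * (2*x)) - 4) - y * (a + 2 * x^2 + 2*x)^2
       = - 4 * a - 4 * y * x^2 * (x^2 + 2 * x + 1 - (2 * x^2 + 1) / 3)"
      unfolding a_def by (simp add: field_simps power2_eq_square)
    moreover have "x^2 + 2 * x + 1 - (2 * x^2 + 1) / 3 \<ge> 0"
      using x by (simp add: field_simps add_nonneg_nonneg)
    ultimately have lt: "a * (y * (a + 4 * x^2 + 4 * (2*x)) - 4) < y * (a + 2 * x^2 + 2*x)^2"
      using a y by (smt (verit) mult_nonneg_nonneg zero_le_power2)
    have "a + 2 * x^2 + 2 * x > 0" using a x by (simp add: add_pos_nonneg)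
    show ?thesis
    proof (rule that[of "2*x" "x^2" a])
      show "(\<Sum>d<2*q. z ^ d) = of_real (2*x)"
        unfolding z1 x_def by (rule cycle_sums_trivial)
      show "(\<Sum>d<2*q. of_nat (min d (2*q - d)) * z ^ d) = of_real (x^2)"
        unfolding z1 x_def by (rule cycle_sums_trivial)
      show "(\<Sum>d<2*q. (of_nat (min d (2*q - d)))^2 * z ^ d) = of_real a"
        unfolding z1 a_def x_def by (rule cycle_sums_trivial)
    qed (use lt \<open>a + 2 * x^2 + 2 * x > 0\<close> in \<open>simp_all add: y_def[symmetric]\<close>)
  next
    case False
    have "z ^ (2*q) = 1" using bij_betwE[OF bij] q k by (auto simp: z_def)
    moreover have "z \<noteq> 1"
    proof
      assume "z = 1"
      then have "k = 0" using bij_betw_imp_inj_on[OF bij] q k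
        by (auto simp: z_def inj_on_def dest!: bspec[of _ _ k] bspec[of _ _ 0])
      then show False using False by simp
    qed
    ultimately obtain e T :: real where eT: "e = 1 \<or> e = -1" "0 < T" "T \<le> 4"
      and sums: "(\<Sum>d<2*q. z ^ d) = 0"
      "(\<Sum>d<2*q. of_nat (min d (2*q - d)) * z ^ d) = of_real (- 2 * (1 - e) / T)"
      "(\<Sum>d<2*q. (of_nat (min d (2*q - d)))^2 * z ^ d) = of_real (4 * e * real q / T)"
      using cycle_sums_nontrivial[of z q] by (auto simp: z_def)
    from eT(1) show ?thesis
    proof
      assume e: "e = 1"
      \<comment> \<open>Here \<open>b\<close> and \<open>j\<close> vanish, so the determinant of the
        block is \<open>- 4 * a\<close>, which is negative.\<close>
      define a where "a = 4 * real q / T"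
      have "a > 0" using eT Q by (simp add: a_def)
      moreover have "a * (real s * a - 4) = real s * a^2 - 4 * a"
        by (simp add: algebra_simps power2_eq_square)
      ultimately show ?thesis using sums e
        by (intro that[of 0 0 a]) (simp_all add: a_def[symmetric])
    next
      assume e: "e = -1"
      define a where "a = - 4 * real q / T"
      define b where "b = - 4 / T"
      have ab: "a < 0" "b < 0" using eT Q by (auto simp: a_def b_def)
      \<comment> \<open>The determinant is \<open>- 4 * a - 4 * real s * b^2\<close> with
        \<open>- 4 * a = 16 * real q / T\<close> and \<open>b^2 = 16 / T^2\<close>, so this
        inequality is exactly its nonpositivity.\<close>
      have "T * real q \<le> 4 * real s" using Q eT by (intro mult_mono) auto
      then have "16 * real q / T \<le> 64 * real s / T^2" using eT
        by (simp add: divide_simps power2_eq_square)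
      then have "- 4 * a \<le> 4 * real s * b^2" by (simp add: a_def b_def power2_eq_square)
      moreover have "a * (real s * (a + 4*b) - 4) - real s * (a + 2*b)^2 = - 4 * a - 4 * real s * b^2"
        by (simp add: algebra_simps power2_eq_square)
      ultimately have "a * (real s * (a + 4*b) - 4) \<le> real s * (a + 2*b)^2" by linarith
      moreover have "- 2 * (1 - e) / T = b" "4 * e * real q / T = a"
        using e by (simp_all add: a_def b_def)
      note sums[unfolded this]
      ultimately show ?thesis using ab by (intro that[of 0 b a]) simp_all
    qed
  qed
qed

text \<open>The characteristic polynomial of the block with rows $(a, sg)$ and $(g, e)$ is
  $(t - \lambda)(t - \mu)$.\<close>

lemma opposite_sign_roots:
  fixes a e g s :: real
  assumes s: "s > 0" and g: "g \<noteq> 0" and det: "a * e \<le> s * g^2" "a * e = s * g^2 \<longrightarrow> a < 0"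
  obtains l m where "l < 0" "0 \<le> m" "l + m = a + e" "l * m = a * e - s * g^2"
proof -
  \<comment> \<open>The radicand is the discriminant, trace squared minus four times the
    determinant.\<close>
  define D where "D = sqrt ((a - e)^2 + 4 * s * g^2)"
  have sg: "s * g^2 > 0" using s g by simp
  have "(a - e)^2 + 4 * s * g^2 \<ge> 0" using s by simp
  then have D: "D^2 = (a - e)^2 + 4 * s * g^2" by (simp add: D_def)
  have "(a + e)^2 \<le> (a - e)^2 + 4 * s * g^2" using det(1) by (simp add: power2_eq_square algebra_simps)
  then have "\<bar>a + e\<bar> \<le> D" unfolding D_def using real_le_rsqrt by fastforce
  define l where "l = (a + e - D) / 2"
  define m where "m = (a + e + D) / 2"
  have lm: "l + m = a + e" by (simp add: l_def m_def field_simps)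
  have "(2 * l) * (2 * m) = (a + e)^2 - D^2"
    by (simp add: l_def m_def) (simp add: algebra_simps power2_eq_square)
  then have prod: "l * m = a * e - s * g^2" unfolding D by (simp add: algebra_simps power2_eq_square)
  have le: "l \<le> 0" "0 \<le> m" using \<open>\<bar>a + e\<bar> \<le> D\<close> by (auto simp: l_def m_def)
  \<comment> \<open>If \<open>l = 0\<close>, the determinant vanishes, so \<open>a\<close> and then
    also \<open>e\<close> are negative; a negative trace contradicts
    \<open>0 \<le> m\<close>.\<close>
  have "l \<noteq> 0"
  proof
    assume "l = 0"
    then have eq: "a * e = s * g^2" using prod by simp
    then have "a < 0" by (rule det(2)[rule_format])
    moreover have "e < 0" using eq sg \<open>a < 0\<close> mult_nonpos_nonneg[of a e] by linarith
    ultimately show False using lm le \<open>l = 0\<close> by simp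
  qed
  then show thesis using that[of l m] le lm prod by simp
qed

subsection \<open>Eigenvectors of the distance squared matrix\<close>

lemma sum_lessThan_mult:
  fixes f :: "nat \<Rightarrow> 'a::comm_monoid_add"
  shows "(\<Sum>r<n * s. f r) = (\<Sum>i<n. \<Sum>j<s. f (i * s + j))"
proof (induction n)
  case (Suc n)
  have "(\<Sum>r<Suc n * s. f r) = (\<Sum>r<n * s + s. f r)" by (simp add: add.commute)
  then show ?case unfolding sum_lessThan_add by (simp add: Suc)
qed simp

lemma U_sum:
  fixes f :: "nat \<Rightarrow> 'a::comm_monoid_add"
  shows "(\<Sum>r<U_nverts q s. f r) = (\<Sum>i<2*q. f i) + (\<Sum>i<2*q. \<Sum>j<s. f (2*q + i*s + j))"
  unfolding U_nverts_def sum_lessThan_add sum_lessThan_mult by (simp add: add.assoc)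

lemma U_vertex_cases:
  assumes "r < U_nverts q s"
  obtains (cycle) "r < 2*q" | (pendant) i j where "i < 2*q" "j < s" "r = 2*q + i*s + j"
proof (cases "r < 2*q")
  case False
  then have "s > 0" using assms by (cases s) (auto simp: U_nverts_def)
  then have "r = 2*q + U_base q s r * s + (r - 2*q) mod s" "(r - 2*q) mod s < s"
    using False by (simp_all add: U_base_def)
  then show thesis using pendant U_base_less[OF assms] by blast
qed (rule cycle)

definition U_vec :: "nat \<Rightarrow> nat \<Rightarrow> (nat \<Rightarrow> complex) \<Rightarrow> (nat \<Rightarrow> nat \<Rightarrow> complex) \<Rightarrow> nat \<Rightarrow> complex" where
  "U_vec q s x y r = (if r < 2*q then x r else y ((r - 2*q) div s) ((r - 2*q) mod s))"

lemma U_vec_cycle: "i < 2*q \<Longrightarrow> U_vec q s x y i = x i"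
  by (simp add: U_vec_def)

lemma U_vec_pendant: "j < s \<Longrightarrow> U_vec q s x y (2*q + i*s + j) = y i j"
  by (simp add: U_vec_def)

lemma U_vec_inner:
  "(\<Sum>r<U_nverts q s. cnj (U_vec q s x y r) * U_vec q s x' y' r)
    = (\<Sum>i<2*q. cnj (x i) * x' i) + (\<Sum>i<2*q. \<Sum>j<s. cnj (y i j) * y' i j)"
  unfolding U_sum by (simp add: U_vec_cycle U_vec_pendant)

definition U_sq :: "nat \<Rightarrow> nat \<Rightarrow> nat \<Rightarrow> nat \<Rightarrow> complex" where
  "U_sq q s r r' = (of_nat (U_dist q s r r'))^2"

lemma U_sq_cycle_cycle:
  assumes "i < 2*q" "i' < 2*q"
  shows "U_sq q s i i' = (of_nat (cycle_dist (2*q) i i'))^2"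
  using assms by (auto simp: U_sq_def U_dist_def U_height_def U_base_def)

lemma U_sq_cycle_pendant:
  assumes "i < 2*q" "j < s"
  shows "U_sq q s i (2*q + i'*s + j) = (of_nat (cycle_dist (2*q) i i') + 1)^2"
    "U_sq q s (2*q + i'*s + j) i = (of_nat (cycle_dist (2*q) i' i) + 1)^2"
proof -
  have "U_base q s i = i" using assms by (simp add: U_base_def)
  then have "U_dist q s i (2*q + i'*s + j) = cycle_dist (2*q) i i' + 1"
    "U_dist q s (2*q + i'*s + j) i = cycle_dist (2*q) i' i + 1"
    using assms by (auto simp: U_dist_def U_base_pendant U_height_def)
  then show "U_sq q s i (2*q + i'*s + j) = (of_nat (cycle_dist (2*q) i i') + 1)^2"
    "U_sq q s (2*q + i'*s + j) i = (of_nat (cycle_dist (2*q) i' i) + 1)^2"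
    unfolding U_sq_def by (simp_all add: add.commute)
qed

text \<open>Distinct pendant vertices at one cycle vertex have distance 2, so only true diagonal
  entries leave the general pattern.\<close>

lemma U_sq_pendant_pendant:
  assumes "j < s" "j' < s"
  shows "U_sq q s (2*q + i*s + j) (2*q + i'*s + j') =
    (if i = i' \<and> j = j' then 0 else (of_nat (cycle_dist (2*q) i i') + 2)^2)"
proof -
  have "2*q + i*s + j = 2*q + i'*s + j' \<longleftrightarrow> i = i' \<and> j = j'"
    using U_base_pendant[OF assms(1), of q i] U_base_pendant[OF assms(2), of q i']
    by (metis add_left_cancel)
  then have "U_dist q s (2*q + i*s + j) (2*q + i'*s + j') =
      (if i = i' \<and> j = j' then 0 else cycle_dist (2*q) i i' + 2)"
    using assms by (auto simp: U_dist_def U_base_pendant U_height_def)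
  then show ?thesis unfolding U_sq_def by (simp add: add.commute)
qed

lemmas U_block = U_vec_cycle U_vec_pendant U_sq_cycle_cycle U_sq_cycle_pendant U_sq_pendant_pendant

lemma U_row_cycle:
  assumes "i < 2*q"
  shows "(\<Sum>r<U_nverts q s. U_sq q s i r * U_vec q s x y r)
    = (\<Sum>i'<2*q. (of_nat (cycle_dist (2*q) i i'))^2 * x i')
    + (\<Sum>i'<2*q. (of_nat (cycle_dist (2*q) i i') + 1)^2 * (\<Sum>j<s. y i' j))"
  unfolding U_sum sum_distrib_left using assms
  by (simp add: U_block)

text \<open>The general pattern would put \<open>2^2\<close> on the diagonal, where the entry is 0;
  the last term corrects this.\<close>

lemma U_row_pendant:
  assumes i: "i < 2*q" and j: "j < s"
  shows "(\<Sum>r<U_nverts q s. U_sq q s (2*q + i*s + j) r * U_vec q s x y r)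
    = (\<Sum>i'<2*q. (of_nat (cycle_dist (2*q) i i') + 1)^2 * x i')
    + (\<Sum>i'<2*q. (of_nat (cycle_dist (2*q) i i') + 2)^2 * (\<Sum>j'<s. y i' j')) - 4 * y i j"
proof -
  have "(\<Sum>i'<2*q. \<Sum>j'<s. U_sq q s (2*q + i*s + j) (2*q + i'*s + j') * y i' j')
    = (\<Sum>i'<2*q. \<Sum>j'<s. (of_nat (cycle_dist (2*q) i i') + 2)^2 * y i' j'
        - (if i' = i then if j' = j then 4 * y i j else 0 else 0))"
    using i j by (intro sum.cong refl) (simp add: U_block)
  also have "\<dots> = (\<Sum>i'<2*q. (of_nat (cycle_dist (2*q) i i') + 2)^2 * (\<Sum>j'<s. y i' j'))
     - (\<Sum>i'<2*q. \<Sum>j'<s. if i' = i then if j' = j then 4 * y i j else 0 else 0)"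
    by (simp add: sum_subtractf sum_distrib_left)
  also have "(\<Sum>i'<2*q. \<Sum>j'<s. if i' = i then if j' = j then 4 * y i j else 0 else 0)
    = (\<Sum>i'<2*q. if i' = i then 4 * y i j else 0)"
    using j by (intro sum.cong refl) simp
  also have "\<dots> = 4 * y i j" using i by simp
  finally show ?thesis
    unfolding U_sum using assms
    by (simp add: U_block)
qed

definition mode_vec :: "nat \<Rightarrow> nat \<Rightarrow> complex \<Rightarrow> real \<Rightarrow> real \<Rightarrow> nat \<Rightarrow> complex" where
  "mode_vec q s z g h = U_vec q s (\<lambda>i. of_real (real s * g) * z ^ i) (\<lambda>i _. of_real h * z ^ i)"

text \<open>For the nontrivial \<open>s\<close>-th roots of unity \<open>w\<close>, these vectors
  form an orthogonal basis of the sum-zero vectors on the pendant vertices at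
  \<open>p\<close>.\<close>

definition local_vec :: "nat \<Rightarrow> nat \<Rightarrow> complex \<Rightarrow> nat \<Rightarrow> nat \<Rightarrow> complex" where
  "local_vec q s w p = U_vec q s (\<lambda>_. 0) (\<lambda>i j. if i = p then w ^ j else 0)"

text \<open>The span of the two vectors $z^i$ on the cycle and $z^i$ on the pendant vertices is invariant,
  and the matrix acts on it by the block with rows $(a, sg)$ and $(g, e)$; a vector
  $(sg, t - a)$ is an eigenvector for each eigenvalue $t$ of this block.\<close>

lemma mode_vec_eigen:
  fixes z :: complex and a b j t :: real
  assumes z: "z ^ (2*q) = 1"
    and S0: "(\<Sum>d<2*q. z ^ d) = of_real j"
    and S1: "(\<Sum>d<2*q. of_nat (min d (2*q - d)) * z ^ d) = of_real b"
    and S2: "(\<Sum>d<2*q. (of_nat (min d (2*q - d)))^2 * z ^ d) = of_real a"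
    and g: "g = a + 2*b + j"
    and t: "(t - a) * (t - (real s * (a + 4*b + 4*j) - 4)) = real s * g^2"
    and r: "r < U_nverts q s"
  shows "(\<Sum>r'<U_nverts q s. U_sq q s r r' * mode_vec q s z g (t - a) r')
    = of_real t * mode_vec q s z g (t - a) r"
proof -
  \<comment> \<open>The constant \<open>c\<close> is the number of pendant ends, 0, 1 or 2.
    Expanding the square reduces the sum to \<open>a\<close>, \<open>b\<close> and
    \<open>j\<close>.\<close>
  have conv: "(\<Sum>i'<2*q. (of_nat (cycle_dist (2*q) i i') + of_real c)^2 * (of_real u * z ^ i'))
      = of_real ((a + 2*c*b + c^2*j) * u) * z ^ i" (is "?L = _") if "i < 2*q" for i and c u :: real
  proof -
    let ?G = "\<lambda>n. (of_nat n + of_real c)^2 * of_real u :: complex"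
    have "?L = (\<Sum>i'<2*q. ?G (cycle_dist (2*q) i i') * z ^ i')" by (simp add: mult.assoc)
    also have "\<dots> = z ^ i * (\<Sum>d<2*q. ?G (min d (2*q - d)) * z ^ d)"
      using that z by (rule cycle_sum_shift)
    also have "(\<Sum>d<2*q. ?G (min d (2*q - d)) * z ^ d)
        = (\<Sum>d<2*q. of_real u * ((of_nat (min d (2*q - d)))^2 * z ^ d)
          + of_real (2*c*u) * (of_nat (min d (2*q - d)) * z ^ d) + of_real (c^2*u) * z ^ d)"
      by (intro sum.cong refl) (simp add: algebra_simps power2_eq_square)
    also have "\<dots> = of_real u * of_real a + of_real (2*c*u) * of_real b + of_real (c^2*u) * of_real j"
      unfolding sum.distrib sum_distrib_left[symmetric] S0 S1 S2 ..
    finally show ?thesis by (simp add: algebra_simps)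
  qed
  let ?h = "t - a"
  have pend: "(\<Sum>j'<s. of_real ?h * z ^ i') = of_real (real s * ?h) * z ^ i'" for i'
    by simp
  from r show ?thesis
  proof (cases rule: U_vertex_cases)
    case cycle
    have "(\<Sum>r'<U_nverts q s. U_sq q s r r' * mode_vec q s z g ?h r')
       = of_real (a * (real s * g) + g * (real s * ?h)) * z ^ r"
      unfolding mode_vec_def U_row_cycle[OF cycle] pend
      using conv[OF cycle, of 0 "real s * g"] conv[OF cycle, of 1 "real s * ?h"]
      by (simp add: g algebra_simps)
    also have "a * (real s * g) + g * (real s * ?h) = t * (real s * g)"
      by (simp add: algebra_simps)
    finally show ?thesis by (simp add: mode_vec_def U_vec_cycle cycle)
  next
    case (pendant i l)
    have "(\<Sum>r'<U_nverts q s. U_sq q s r r' * mode_vec q s z g ?h r')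
       = of_real (g * (real s * g) + (a + 4*b + 4*j) * (real s * ?h) - 4 * ?h) * z ^ i"
      unfolding mode_vec_def pendant(3) U_row_pendant[OF pendant(1,2)] pend
      using conv[OF pendant(1), of 1 "real s * g"] conv[OF pendant(1), of 2 "real s * ?h"]
      by (simp add: g algebra_simps)
    \<comment> \<open>The second row of the block is where the characteristic equation for
      \<open>t\<close> enters; the first row holds by the choice of the vector.\<close>
    also have "g * (real s * g) + (a + 4*b + 4*j) * (real s * ?h) - 4 * ?h = t * ?h"
      using t by (simp add: algebra_simps power2_eq_square)
    finally show ?thesis by (simp add: mode_vec_def U_vec_pendant pendant)
  qed
qed

text \<open>All entries apart from the diagonal correction are constant on the pendant vertices at
  \<open>p\<close>, so they contribute 0 and \<open>- 4\<close> remains.\<close>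

lemma local_vec_eigen:
  assumes w: "(\<Sum>j<s. w ^ j) = 0" and r: "r < U_nverts q s"
  shows "(\<Sum>r'<U_nverts q s. U_sq q s r r' * local_vec q s w p r') = - 4 * local_vec q s w p r"
proof -
  have pend: "(\<Sum>j<s. if i' = p then w ^ j else 0) = 0" for i'
    using w by (cases "i' = p") auto
  from r show ?thesis
  proof (cases rule: U_vertex_cases)
    case cycle
    then show ?thesis unfolding local_vec_def U_row_cycle[OF cycle] pend
      by (simp add: U_vec_cycle)
  next
    case (pendant i l)
    then show ?thesis unfolding local_vec_def pendant(3) U_row_pendant[OF pendant(1,2)] pend
      by (simp add: U_vec_pendant)
  qed
qed

section \<open>Roots of unity and orthogonality of the eigenvectors\<close>

definition unity_root :: "nat \<Rightarrow> nat \<Rightarrow> complex" where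
  "unity_root n k = cis (2 * pi * real k / real n)"

lemma unity_root_power: "k < n \<Longrightarrow> unity_root n k ^ n = 1"
  using bij_betwE[OF bij_betw_roots_unity[of n]] by (auto simp: unity_root_def)

lemma unity_root_eq_iff: "k < n \<Longrightarrow> k' < n \<Longrightarrow> unity_root n k = unity_root n k' \<longleftrightarrow> k = k'"
  using bij_betw_imp_inj_on[OF bij_betw_roots_unity[of n]]
  by (auto simp: unity_root_def inj_on_def)

text \<open>This is a geometric sum whose ratio is an \<open>n\<close>-th root of unity, equal to 1
  only for \<open>k = k'\<close>.\<close>

lemma unity_root_orthogonal:
  assumes "k < n" "k' < n"
  shows "(\<Sum>i<n. cnj (unity_root n k ^ i) * unity_root n k' ^ i) = (if k = k' then of_nat n else 0)"
proof -
  define z where "z = cnj (unity_root n k) * unity_root n k'"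
  have unit: "unity_root n k * cnj (unity_root n k) = 1"
    by (simp add: unity_root_def complex_norm_square[symmetric])
  have sum: "(\<Sum>i<n. cnj (unity_root n k ^ i) * unity_root n k' ^ i) = (\<Sum>i<n. z ^ i)"
    by (simp add: z_def power_mult_distrib)
  show ?thesis
  proof (cases "k = k'")
    case True
    then have "z = 1" using unit by (simp add: z_def mult.commute)
    then show ?thesis using sum True by simp
  next
    case False
    have "z \<noteq> 1"
    proof
      assume "z = 1"
      then have "unity_root n k * z = unity_root n k" by simp
      moreover have "unity_root n k * z = unity_root n k'"
        unfolding z_def using unit by (simp add: mult.assoc[symmetric])
      ultimately show False using unity_root_eq_iff[OF assms] False by simp
    qed
    moreover have "z ^ n = 1"
      using unity_root_power assms by (simp add: z_def power_mult_distrib flip: complex_cnj_power)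
    ultimately show ?thesis using sum power_sum_0[of z n] False by simp
  qed
qed

lemma unity_root_sum:
  assumes "0 < l" "l < n"
  shows "(\<Sum>j<n. unity_root n l ^ j) = 0"
  using unity_root_orthogonal[of 0 n l] assms by (simp add: unity_root_def)

text \<open>Different modes are orthogonal by the Fourier relations. Within one mode, orthogonality
  amounts to \<open>real s * g * g' + h * h' = 0\<close>.\<close>

lemma mode_mode_inner:
  assumes "k < 2*q" "k' < 2*q"
  shows "(\<Sum>r<U_nverts q s. cnj (mode_vec q s (unity_root (2*q) k) g h r)
      * mode_vec q s (unity_root (2*q) k') g' h' r)
    = (if k = k' then of_real (2 * real q * real s * (real s * g * g' + h * h')) else 0)"
proof -
  let ?I = "\<Sum>i<2*q. cnj (unity_root (2*q) k ^ i) * unity_root (2*q) k' ^ i"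
  have "(\<Sum>r<U_nverts q s. cnj (mode_vec q s (unity_root (2*q) k) g h r)
      * mode_vec q s (unity_root (2*q) k') g' h' r)
    = of_real (real s * (real s * g * g' + h * h')) * ?I"
    unfolding mode_vec_def U_vec_inner
    by (simp add: sum_distrib_left sum.distrib[symmetric] algebra_simps)
  then show ?thesis unfolding unity_root_orthogonal[OF assms] by (simp add: algebra_simps)
qed

text \<open>A mode vector is constant on the pendant vertices at each cycle vertex, while a local
  vector sums to 0 there.\<close>

lemma mode_local_inner:
  assumes "(\<Sum>j<s. w ^ j) = 0"
  shows "(\<Sum>r<U_nverts q s. cnj (mode_vec q s z g h r) * local_vec q s w p r) = 0"
proof -
  have "(\<Sum>j<s. cnj (of_real h * z ^ i) * (if i = p then w ^ j else 0)) = 0" for i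
    using assms by (cases "i = p") (simp_all flip: sum_distrib_left)
  then show ?thesis unfolding mode_vec_def local_vec_def U_vec_inner by simp
qed

lemma local_mode_inner:
  assumes "(\<Sum>j<s. w ^ j) = 0"
  shows "(\<Sum>r<U_nverts q s. cnj (local_vec q s w p r) * mode_vec q s z g h r) = 0"
proof -
  have "(\<Sum>r<U_nverts q s. cnj (local_vec q s w p r) * mode_vec q s z g h r)
    = cnj (\<Sum>r<U_nverts q s. cnj (mode_vec q s z g h r) * local_vec q s w p r)"
    by (simp add: mult.commute)
  then show ?thesis by (simp add: mode_local_inner[OF assms])
qed

lemma local_local_inner:
  assumes "p < 2*q" "l < s" "l' < s"
  shows "(\<Sum>r<U_nverts q s. cnj (local_vec q s (unity_root s l) p r)
      * local_vec q s (unity_root s l') p' r) = (if p = p' \<and> l = l' then of_nat s else 0)"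
proof -
  have "(\<Sum>j<s. cnj (if i = p then unity_root s l ^ j else 0) * (if i = p' then unity_root s l' ^ j else 0))
     = (if i = p then if p = p' \<and> l = l' then of_nat s else 0 else 0)" for i
    using unity_root_orthogonal[OF assms(2,3)] by (cases "i = p"; cases "p = p'") auto
  then show ?thesis unfolding local_vec_def U_vec_inner using assms(1) by simp
qed

section \<open>Assembling the eigenbasis\<close>

lemma mode_block:
  assumes q: "q \<ge> 1" and s: "s \<ge> q" and k: "k < 2*q"
  shows "\<exists>a g l m. g \<noteq> 0 \<and> l < 0 \<and> 0 \<le> m \<and> real s * g^2 + (l - a) * (m - a) = 0 \<and>
    (\<forall>t\<in>{l, m}. \<forall>r<U_nverts q s.
      (\<Sum>r'<U_nverts q s. U_sq q s r r' * mode_vec q s (unity_root (2*q) k) g (t - a) r')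
      = of_real t * mode_vec q s (unity_root (2*q) k) g (t - a) r)"
proof -
  obtain j b a :: real where sums: "(\<Sum>d<2*q. unity_root (2*q) k ^ d) = of_real j"
      "(\<Sum>d<2*q. of_nat (min d (2*q - d)) * unity_root (2*q) k ^ d) = of_real b"
      "(\<Sum>d<2*q. (of_nat (min d (2*q - d)))^2 * unity_root (2*q) k ^ d) = of_real a"
    and nz: "a + 2*b + j \<noteq> 0"
    and det: "a * (real s * (a + 4*b + 4*j) - 4) \<le> real s * (a + 2*b + j)^2"
      "a * (real s * (a + 4*b + 4*j) - 4) = real s * (a + 2*b + j)^2 \<longrightarrow> a < 0"
    by (rule cycle_mode[OF assms, folded unity_root_def])
  define g where "g = a + 2*b + j"
  define e where "e = real s * (a + 4*b + 4*j) - 4"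
  have "real s > 0" using q s by simp
  then obtain l m where lm: "l < 0" "0 \<le> m" "l + m = a + e" "l * m = a * e - real s * g^2"
    by (rule opposite_sign_roots[OF _ nz det, folded g_def e_def])
  have root: "(t - a) * (t - e) = real s * g^2" if "t \<in> {l, m}" for t
  proof -
    have "(t - a) * (t - e) = t^2 - (l + m) * t + a * e"
      unfolding lm(3) by (simp add: algebra_simps power2_eq_square)
    also have "\<dots> = a * e - l * m" using that by (auto simp: algebra_simps power2_eq_square)
    finally show ?thesis using lm(4) by simp
  qed
  \<comment> \<open>Trace and determinant yield the relation that makes the two eigenvectors of this
    mode orthogonal.\<close>
  have "(l - a) * (m - a) = l * m - a * (l + m) + a * a" by (simp add: algebra_simps)
  then have "real s * g^2 + (l - a) * (m - a) = 0" unfolding lm(3,4) by (simp add: algebra_simps)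
  moreover have "\<forall>t\<in>{l, m}. \<forall>r<U_nverts q s.
      (\<Sum>r'<U_nverts q s. U_sq q s r r' * mode_vec q s (unity_root (2*q) k) g (t - a) r')
      = of_real t * mode_vec q s (unity_root (2*q) k) g (t - a) r"
    using mode_vec_eigen[OF unity_root_power[OF k] sums g_def root[unfolded e_def]] by blast
  ultimately show ?thesis using lm nz unfolding g_def by blast
qed

text \<open>The eigenvectors are indexed by the vertices: the cycle vertex $k$ carries the nonnegative
  eigenvalue of the $k$-th Fourier mode, the first pendant vertex at $k$ the negative one, and the
  other pendant vertices carry the eigenvalue $-4$.\<close>

lemma U_char_poly:
  assumes q: "q \<ge> 1" and s: "s \<ge> q"
  obtains d :: "nat \<Rightarrow> real" where
    "char_poly (dist_sq_matrix (U_nverts q s) (U_adj q s)) = (\<Prod>m<U_nverts q s. [:- d m, 1:])"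
    "\<And>m. m < U_nverts q s \<Longrightarrow> d m < 0 \<longleftrightarrow> 2*q \<le> m"
proof -
  interpret map_poly_inj_idom_hom complex_of_real ..
  let ?n = "U_nverts q s" and ?z = "unity_root (2*q)" and ?w = "unity_root s"
  define P where "P = (\<lambda>k a g l m. g \<noteq> 0 \<and> l < 0 \<and> 0 \<le> m \<and> real s * g^2 + (l - a) * (m - a) = 0 \<and>
    (\<forall>t\<in>{l, m}. \<forall>r<?n. (\<Sum>r'<?n. U_sq q s r r' * mode_vec q s (?z k) g (t - a) r')
      = of_real t * mode_vec q s (?z k) g (t - a) r))"
  have "\<forall>k\<in>{..<2*q}. \<exists>a g l m. P k a g l m"
    using mode_block[OF assms] unfolding P_def by blast
  then obtain a g l m where "\<forall>k\<in>{..<2*q}. P k (a k) (g k) (l k) (m k)"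
    unfolding bchoice_iff by blast
  then have P: "P k (a k) (g k) (l k) (m k)" if "k < 2*q" for k using that by blast
  define M where "M = (\<lambda>k t. mode_vec q s (?z k) (g k) (t - a k))"
  define L where "L = (\<lambda>p i. local_vec q s (?w i) p)"
  define base where "base = U_base q s"
  \<comment> \<open>Truncated subtraction gives cycle vertices offset 0. So \<open>base\<close> and
    \<open>off\<close> agree on a cycle vertex and its first pendant vertex, which carry the two
    eigenvectors of one mode.\<close>
  define off where "off = (\<lambda>r. (r - 2*q) mod s)"
  define d where "d = (\<lambda>r. if r < 2*q then m r else if off r = 0 then l (base r) else -4)"
  define v where "v = (\<lambda>r. if r < 2*q \<or> off r = 0 then M (base r) (d r) else L (base r) (off r))"
  have s0: "s > 0" using q s by simp
  have base: "base r < 2*q" "off r < s" if "r < ?n" for r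
    using U_base_less[OF that] s0 by (auto simp: base_def off_def)
  have inj: "r = r'" if "r \<ge> 2*q" "r' \<ge> 2*q" "base r = base r'" "off r = off r'" for r r'
    using that by (auto simp: base_def off_def U_base_def)
      (metis le_add_diff_inverse div_mult_mod_eq)
  have base_cycle: "base r = r" if "r < 2*q" for r using that by (simp add: base_def U_base_def)
  have dval: "d r \<in> {l (base r), m (base r)}" if "r < 2*q \<or> off r = 0" for r
    using that by (auto simp: d_def base_cycle)
  have wsum: "(\<Sum>j<s. ?w (off r) ^ j) = 0" if "r < ?n" "off r \<noteq> 0" for r
    using unity_root_sum that base(2) by simp
  define A where "A = mat ?n ?n (\<lambda>(i, j). U_sq q s i j)"
  have "char_poly A = (\<Prod>r<?n. [:- complex_of_real (d r), 1:])"
  proof (rule char_poly_orthogonal_eigenbasis[where v = v])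
    show "A \<in> carrier_mat ?n ?n" by (simp add: A_def)
  next
    fix r i assume r: "r < ?n" and i: "i < ?n"
    have "(\<Sum>j<?n. A $$ (i, j) * v r j) = (\<Sum>j<?n. U_sq q s i j * v r j)"
      using i by (simp add: A_def)
    also have "\<dots> = of_real (d r) * v r i"
    proof (cases "r < 2*q \<or> off r = 0")
      case True
      have "\<forall>t\<in>{l (base r), m (base r)}. \<forall>i<?n.
        (\<Sum>j<?n. U_sq q s i j * M (base r) t j) = of_real t * M (base r) t i"
        using P[OF base(1)[OF r]] unfolding P_def M_def by blast
      then have "(\<Sum>j<?n. U_sq q s i j * M (base r) (d r) j) = of_real (d r) * M (base r) (d r) i"
        using dval[OF True] i by blast
      then show ?thesis using True by (simp add: v_def)
    next
      case False
      then show ?thesis using local_vec_eigen[OF wsum[OF r] i] by (simp add: v_def L_def d_def)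
    qed
    finally show "(\<Sum>j<?n. A $$ (i, j) * v r j) = of_real (d r) * v r i" .
  next
    fix r r' assume r: "r < ?n" "r' < ?n" "r \<noteq> r'"
    note br = base[OF r(1)] base[OF r(2)]
    show "(\<Sum>i<?n. cnj (v r i) * v r' i) = 0"
    proof (cases "r < 2*q \<or> off r = 0"; cases "r' < 2*q \<or> off r' = 0")
      assume *: "r < 2*q \<or> off r = 0" "r' < 2*q \<or> off r' = 0"
      have "real s * g (base r) * g (base r) + (d r - a (base r)) * (d r' - a (base r)) = 0"
        if eq: "base r = base r'"
      proof -
        \<comment> \<open>Two different indices of the same mode must be the cycle vertex and its
          first pendant vertex, so they carry both eigenvalues of the block.\<close>
        have "(r < 2*q) \<noteq> (r' < 2*q)"
          using * inj[of r r'] r(3) eq base_cycle[of r] base_cycle[of r'] by force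
        then have "{d r, d r'} = {l (base r), m (base r)}"
          using * eq base_cycle[of r] base_cycle[of r'] by (auto simp: d_def)
        then have "(d r - a (base r)) * (d r' - a (base r))
            = (l (base r) - a (base r)) * (m (base r) - a (base r))"
          by (auto simp: doubleton_eq_iff mult.commute)
        then show ?thesis using P[OF br(1)] by (simp add: P_def power2_eq_square mult.assoc)
      qed
      then show ?thesis using * mode_mode_inner[OF br(1,3)]
        by (auto simp: v_def M_def)
    next
      assume "r < 2*q \<or> off r = 0" "\<not> (r' < 2*q \<or> off r' = 0)"
      then show ?thesis using mode_local_inner[OF wsum[OF r(2)]] by (simp add: v_def M_def L_def)
    next
      assume "\<not> (r < 2*q \<or> off r = 0)" "r' < 2*q \<or> off r' = 0"
      then show ?thesis using local_mode_inner[OF wsum[OF r(1)]] by (simp add: v_def M_def L_def)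
    next
      assume *: "\<not> (r < 2*q \<or> off r = 0)" "\<not> (r' < 2*q \<or> off r' = 0)"
      then have "\<not> (base r = base r' \<and> off r = off r')" using inj[of r r'] r(3) by auto
      then show ?thesis using * local_local_inner[OF br(1,2,4)] by (auto simp: v_def L_def)
    qed
  next
    fix r assume r: "r < ?n"
    note br = base[OF r]
    show "(\<Sum>i<?n. cnj (v r i) * v r i) \<noteq> 0"
    proof (cases "r < 2*q \<or> off r = 0")
      case True
      have "g (base r) \<noteq> 0" using P[OF br(1)] by (simp add: P_def)
      then have "real s * (g (base r) * g (base r)) > 0"
        using s0 by (auto simp: zero_less_mult_iff linorder_neq_iff)
      then have "real s * g (base r) * g (base r) + (d r - a (base r)) * (d r - a (base r)) > 0"
        by (simp add: mult.assoc add_pos_nonneg)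
      then have "2 * real q * real s
          * (real s * g (base r) * g (base r) + (d r - a (base r)) * (d r - a (base r))) \<noteq> 0"
        using q s0 by simp
      then show ?thesis using True mode_mode_inner[OF br(1,1), of s "g (base r)" _ "g (base r)"]
        by (simp only: v_def M_def if_True of_real_eq_0_iff simp_thms)
    next
      case False
      then show ?thesis using local_local_inner[OF br(1,2,2)] s0 by (simp add: v_def L_def)
    qed
  qed
  moreover have "A = map_mat complex_of_real (dist_sq_matrix ?n (U_adj q s))"
    by (rule eq_matI) (auto simp: A_def dist_sq_matrix_def U_sq_def U_graph_dist)
  \<comment> \<open>The eigenvectors are complex but the eigenvalues are real, so the factorization
    descends to the reals by injectivity of the embedding.\<close>
  ultimately have "map_poly complex_of_real (char_poly (dist_sq_matrix ?n (U_adj q s)))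
      = (\<Prod>r<?n. [:- complex_of_real (d r), 1:])"
    by (subst of_real_hom.char_poly_hom[symmetric, where n = ?n]) (auto simp: dist_sq_matrix_def)
  also have "\<dots> = map_poly complex_of_real (\<Prod>r<?n. [:- d r, 1:])"
    by (simp add: hom_prod)
  finally have "char_poly (dist_sq_matrix ?n (U_adj q s)) = (\<Prod>r<?n. [:- d r, 1:])"
    by simp
  moreover have "d r < 0 \<longleftrightarrow> 2*q \<le> r" if "r < ?n" for r
    using P[of r] P[OF base(1)[OF that]] by (auto simp: P_def d_def)
  ultimately show thesis by (rule that)
qed

theorem theorem7p1:
  fixes q s :: nat
  assumes "q \<ge> 2" and "s \<ge> q"
  shows "neg_inertia (dist_sq_matrix (U_nverts q s) (U_adj q s)) = 2*q*s"
proof -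
  have "q \<ge> 1" using assms(1) by simp
  then obtain d :: "nat \<Rightarrow> real" where
    cp: "char_poly (dist_sq_matrix (U_nverts q s) (U_adj q s)) = (\<Prod>m<U_nverts q s. [:- d m, 1:])"
    and d: "\<And>m. m < U_nverts q s \<Longrightarrow> d m < 0 \<longleftrightarrow> 2*q \<le> m"
    using U_char_poly[OF _ assms(2)] by blast
  have "{m. m < U_nverts q s \<and> d m < 0} = {2*q..<U_nverts q s}" using d by auto
  then show ?thesis using neg_inertia_linear_factors[OF cp] by (simp add: U_nverts_def)
qed

end
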